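(* Let $S$ be a finite semigroup. The enhanced power graph $P_e(S)$ is complete if and only if $S$ is a monogenic semigroup.
   Context: Semigroups are nonempty. $\mathbb{N}$ is the set of positive integers. For $a\in S$, $\langle a\rangle=\{a^k : k\in\mathbb{N}\}$ is the subsemigroup generated by $a$. A semigroup $S$ is monogenic if $S=\langle a\rangle$ for some $a\in S$. The enhanced power graph $P_e(S)$ is the simple graph with vertex set $S$ in which two distinct vertices $x,y$ are adjacent if and only if there exists $z\in S$ with $x,y\in\langle z\rangle$. A graph is complete if any two distinct vertices are adjacent. *)

theory Defs
  imports "Graph_Theory.Kuratowski"
begin

text \<open>
  A semigroup is a type of class \<^class>\<open>semigroup_mult\<close>; being a type, it is nonempty.
  The semigroup itself is referred to as \<open>TYPE('a)\<close>.
\<close>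

text \<open>
  Class \<^class>\<open>semigroup_mult\<close> has no unit, so the power operator of class \<^class>\<open>power\<close>
  is not available. The exponent is meant to be positive; the value at exponent 0 is a dummy.
\<close>
definition spow :: "'a::semigroup_mult \<Rightarrow> nat \<Rightarrow> 'a" where
  "spow a k = ((\<lambda>x. x * a) ^^ (k - 1)) a"

lemma spow_1 [simp]: "spow a (Suc 0) = a"
  by (simp add: spow_def)

lemma spow_Suc: "k \<ge> 1 \<Longrightarrow> spow a (Suc k) = spow a k * a"
  by (cases k) (simp_all add: spow_def)

definition monogenic_subsemigroup :: "'a::semigroup_mult \<Rightarrow> 'a set" where
  "monogenic_subsemigroup a = {spow a k | k. k \<ge> 1}"

definition monogenic :: "'a::semigroup_mult itself \<Rightarrow> bool" where
  "monogenic S \<longleftrightarrow> (\<exists>a::'a. UNIV = monogenic_subsemigroup a)"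

text \<open>
  As usual in \<open>Graph_Theory\<close>, a simple graph is a loop-free symmetric digraph without
  parallel arcs.
\<close>
definition enhanced_power_graph :: "'a::semigroup_mult itself \<Rightarrow> 'a pair_pre_digraph" where
  "enhanced_power_graph S =
    \<lparr> pverts = UNIV,
      parcs = {(x, y). x \<noteq> y \<and>
        (\<exists>z. x \<in> monogenic_subsemigroup z \<and> y \<in> monogenic_subsemigroup z)} \<rparr>"

definition complete_graph :: "('a, 'b) pre_digraph \<Rightarrow> bool" where
  "complete_graph G \<longleftrightarrow> (\<forall>u\<in>verts G. \<forall>v\<in>verts G. u \<noteq> v \<longrightarrow> u \<rightarrow>\<^bsub>G\<^esub> v)"

lemma graph_enhanced_power_graph:
  "pair_graph (enhanced_power_graph TYPE('a::{semigroup_mult, finite}))"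
  by unfold_locales (auto simp: enhanced_power_graph_def symmetric_def sym_def)

lemma complete_graph_iff_complete_digraph:
  assumes "graph G"
  shows "complete_graph G \<longleftrightarrow> K\<^bsub>card (verts G)\<^esub> G"
proof -
  interpret graph G by fact
  show ?thesis
    using assms by (auto simp: complete_graph_def complete_digraph_def dest: adj_in_verts adj_not_same)
qed

end

theory Submission
  imports Defs
begin

text \<open>
  Completeness says that any two elements lie in a common monogenic subsemigroup. If
  \<open>z\<close> generates a monogenic subsemigroup of maximal cardinality and \<open>y\<close> is arbitrary, then
  \<open>z\<close> and \<open>y\<close> both lie in some \<open>\<langle>w\<rangle>\<close>, whence \<open>\<langle>z\<rangle> \<subseteq> \<langle>w\<rangle>\<close> by
  \<open>monogenic_subsemigroup_mono\<close>. Maximality forces equality, so \<open>y \<in> \<langle>z\<rangle>\<close>, and \<open>z\<close>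
  generates the whole semigroup. Conversely, a generator of the semigroup witnesses every
  adjacency.
\<close>

lemma spow_add:
  assumes "m \<ge> 1" "n \<ge> 1"
  shows "spow a (m + n) = spow a m * spow a n"
  using assms(2)
proof (induction n rule: dec_induct)
  case base
  show ?case using assms(1) by (simp add: spow_Suc)
next
  case (step n)
  then show ?case using assms(1) by (simp add: spow_Suc mult.assoc)
qed

lemma generator_in_monogenic_subsemigroup: "a \<in> monogenic_subsemigroup a"
  unfolding monogenic_subsemigroup_def by (force intro: exI[of _ "Suc 0"])

lemma monogenic_subsemigroup_mult_closed:
  assumes "x \<in> monogenic_subsemigroup a" "y \<in> monogenic_subsemigroup a"
  shows "x * y \<in> monogenic_subsemigroup a"
proof -
  obtain m n where mn: "m \<ge> 1" "n \<ge> 1" and "x = spow a m" "y = spow a n"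
    using assms by (auto simp: monogenic_subsemigroup_def)
  then have "x * y = spow a (m + n)" by (simp add: spow_add)
  moreover have "m + n \<ge> 1" using mn by simp
  ultimately show ?thesis unfolding monogenic_subsemigroup_def by blast
qed

lemma monogenic_subsemigroup_mono:
  assumes "z \<in> monogenic_subsemigroup w"
  shows "monogenic_subsemigroup z \<subseteq> monogenic_subsemigroup w"
proof
  fix x assume "x \<in> monogenic_subsemigroup z"
  then obtain k where "k \<ge> 1" and x: "x = spow z k"
    by (auto simp: monogenic_subsemigroup_def)
  from \<open>k \<ge> 1\<close> have "spow z k \<in> monogenic_subsemigroup w"
  proof (induction k rule: dec_induct)
    case base
    show ?case using assms by simp
  next
    case (step k)
    then show ?case using assms by (simp add: spow_Suc monogenic_subsemigroup_mult_closed)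
  qed
  then show "x \<in> monogenic_subsemigroup w" using x by simp
qed

text \<open>
  The diagonal case \<open>x = y\<close>, on which adjacency is silent, is harmless because every element
  lies in the subsemigroup that it generates.
\<close>
lemma complete_enhanced_power_graph_iff:
  "complete_graph (with_proj (enhanced_power_graph TYPE('a::semigroup_mult)))
    \<longleftrightarrow> (\<forall>x y :: 'a. \<exists>w. x \<in> monogenic_subsemigroup w \<and> y \<in> monogenic_subsemigroup w)"
proof -
  have "complete_graph (with_proj (enhanced_power_graph TYPE('a)))
    \<longleftrightarrow> (\<forall>x y :: 'a. x \<noteq> y \<longrightarrow>
      (\<exists>w. x \<in> monogenic_subsemigroup w \<and> y \<in> monogenic_subsemigroup w))"
    by (auto simp: complete_graph_def enhanced_power_graph_def)
  then show ?thesis using generator_in_monogenic_subsemigroup by metis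
qed

theorem theorem3p2:
  shows "complete_graph (with_proj (enhanced_power_graph TYPE('a::{semigroup_mult, finite})))
    \<longleftrightarrow> monogenic TYPE('a)"
proof
  assume "complete_graph (with_proj (enhanced_power_graph TYPE('a)))"
  then have common: "\<exists>w. x \<in> monogenic_subsemigroup w \<and> y \<in> monogenic_subsemigroup w" for x y :: 'a
    by (simp add: complete_enhanced_power_graph_iff)
  let ?size = "\<lambda>a :: 'a. card (monogenic_subsemigroup a)"
  have "Max (range ?size) \<in> range ?size" by (rule Max_in) auto
  then obtain z where z: "Max (range ?size) = ?size z" by (rule imageE)
  have maximal: "?size w \<le> ?size z" for w
    unfolding z[symmetric] by (rule Max_ge) auto
  have "y \<in> monogenic_subsemigroup z" for y
  proof -
    obtain w where "z \<in> monogenic_subsemigroup w" and y: "y \<in> monogenic_subsemigroup w"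
      using common by blast
    then have "monogenic_subsemigroup z = monogenic_subsemigroup w"
      using maximal by (intro card_seteq monogenic_subsemigroup_mono) auto
    with y show ?thesis by simp
  qed
  then show "monogenic TYPE('a)" unfolding monogenic_def by blast
next
  assume "monogenic TYPE('a)"
  then show "complete_graph (with_proj (enhanced_power_graph TYPE('a)))"
    unfolding complete_enhanced_power_graph_iff monogenic_def by blast
qed

end
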